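(* Let $G=(V,E)$ be a hypergraph with at most $m\ge|E|$ edges, capacities $c_v>0$ with $c_{\min}=\min_v c_v$, multiplicity $\mu\ge1$, and $f\ge\max_{e\in E}|\mathcal{V}_e|$. Let $\alpha,\beta>1$ and $L=\lceil\log_\beta(m\mu\alpha/c_{\min})\rceil$. Consider an $(\alpha,\beta)$-partition $\ell:V\to\{0,\dots,L\}$ satisfying the invariant: for every node $v$ with $\ell(v)>0$ we have $c^*_v\le W_v\le f\alpha\beta\cdot c^*_v$, and for every node $v$ with $\ell(v)=0$ we have $W_v\le f\alpha\beta\cdot c^*_v$, where $c^*_v=c_v/(f\alpha\beta)$. Then the edge weights $\{w(e)\}_{e\in E}$ form an $(f\alpha\beta)$-maximal solution of the LP: maximize $\sum_{e\in E}x(e)$ subject to $\sum_{e\in\mathcal{E}_v}x(e)\le c_v$ for all $v\in V$ and $0\le x(e)\le\mu$ for all $e\in E$.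
   Context: For $v\in V$, $\mathcal{E}_v$ is the set of edges incident upon $v$ and for $e\in E$, $\mathcal{V}_e=\{v:e\in\mathcal{E}_v\}$. An $(\alpha,\beta)$-partition assigns each node $v$ a level $\ell(v)\in\{0,\dots,L\}$; the level of an edge is $\ell(e)=\max_{v\in\mathcal{V}_e}\ell(v)$, its weight is $w(e)=\mu\cdot\beta^{-\ell(e)}$, and $W_v=\sum_{e\in\mathcal{E}_v}w(e)$. A feasible LP solution $x$ is $\lambda$-maximal if for every edge $e$ with $x(e)<\mu$ there is a node $v\in\mathcal{V}_e$ with $\sum_{e'\in\mathcal{E}_v}x(e')\ge c_v/\lambda$. *)

theory Defs
  imports Complex_Main
begin

text \<open>
  A hypergraph is given by its node set \<open>V\<close>, its edge set \<open>E\<close> and the incidence map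
  \<open>I\<close>, where \<open>I v\<close> is \<open>\<E>\<^sub>v\<close>; distinct edges may have the same set of endpoints.
  Edges are nonempty, so that the maximum defining the level of an edge exists.
\<close>

definition edge_nodes :: "'v set \<Rightarrow> ('v \<Rightarrow> 'e set) \<Rightarrow> 'e \<Rightarrow> 'v set" where
  "edge_nodes V I e = {v \<in> V. e \<in> I v}"

definition hypergraph :: "'v set \<Rightarrow> 'e set \<Rightarrow> ('v \<Rightarrow> 'e set) \<Rightarrow> bool" where
  "hypergraph V E I \<longleftrightarrow>
     finite V \<and> finite E \<and> (\<forall>v\<in>V. I v \<subseteq> E) \<and> (\<forall>e\<in>E. edge_nodes V I e \<noteq> {})"

definition lp_feasible ::
  "'v set \<Rightarrow> 'e set \<Rightarrow> ('v \<Rightarrow> 'e set) \<Rightarrow> ('v \<Rightarrow> real) \<Rightarrow> real \<Rightarrow> ('e \<Rightarrow> real) \<Rightarrow> bool" where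
  "lp_feasible V E I c \<mu> x \<longleftrightarrow>
     (\<forall>v\<in>V. (\<Sum>e\<in>I v. x e) \<le> c v) \<and> (\<forall>e\<in>E. 0 \<le> x e \<and> x e \<le> \<mu>)"

definition lp_maximal ::
  "real \<Rightarrow> 'v set \<Rightarrow> 'e set \<Rightarrow> ('v \<Rightarrow> 'e set) \<Rightarrow> ('v \<Rightarrow> real) \<Rightarrow> real \<Rightarrow> ('e \<Rightarrow> real) \<Rightarrow> bool" where
  "lp_maximal k V E I c \<mu> x \<longleftrightarrow>
     lp_feasible V E I c \<mu> x \<and>
     (\<forall>e\<in>E. x e < \<mu> \<longrightarrow> (\<exists>v\<in>edge_nodes V I e. (\<Sum>e'\<in>I v. x e') \<ge> c v / k))"

definition top_level :: "real \<Rightarrow> real \<Rightarrow> nat \<Rightarrow> real \<Rightarrow> 'v set \<Rightarrow> ('v \<Rightarrow> real) \<Rightarrow> int" where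
  "top_level \<alpha> \<beta> m \<mu> V c = \<lceil>log \<beta> (real m * \<mu> * \<alpha> / Min (c ` V))\<rceil>"

definition ab_partition ::
  "real \<Rightarrow> real \<Rightarrow> nat \<Rightarrow> real \<Rightarrow> 'v set \<Rightarrow> ('v \<Rightarrow> real) \<Rightarrow> ('v \<Rightarrow> int) \<Rightarrow> bool" where
  "ab_partition \<alpha> \<beta> m \<mu> V c l \<longleftrightarrow> (\<forall>v\<in>V. l v \<in> {0..top_level \<alpha> \<beta> m \<mu> V c})"

definition edge_level :: "'v set \<Rightarrow> ('v \<Rightarrow> 'e set) \<Rightarrow> ('v \<Rightarrow> int) \<Rightarrow> 'e \<Rightarrow> int" where
  "edge_level V I l e = Max (l ` edge_nodes V I e)"

definition edge_weight ::
  "real \<Rightarrow> real \<Rightarrow> 'v set \<Rightarrow> ('v \<Rightarrow> 'e set) \<Rightarrow> ('v \<Rightarrow> int) \<Rightarrow> 'e \<Rightarrow> real" where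
  "edge_weight \<beta> \<mu> V I l e = \<mu> * \<beta> powi (- edge_level V I l e)"

definition node_weight ::
  "real \<Rightarrow> real \<Rightarrow> 'v set \<Rightarrow> ('v \<Rightarrow> 'e set) \<Rightarrow> ('v \<Rightarrow> int) \<Rightarrow> 'v \<Rightarrow> real" where
  "node_weight \<beta> \<mu> V I l v = (\<Sum>e\<in>I v. edge_weight \<beta> \<mu> V I l e)"

definition star_capacity :: "real \<Rightarrow> real \<Rightarrow> nat \<Rightarrow> ('v \<Rightarrow> real) \<Rightarrow> 'v \<Rightarrow> real" where
  "star_capacity \<alpha> \<beta> f c v = c v / (real f * \<alpha> * \<beta>)"

end

theory Submission
  imports Defs
begin

text \<open>Feasibility: node levels are nonnegative and \<beta> > 1, so weights lie between 0 and
  \<mu>, and the invariant bounds the load of each node by \<open>f * \<alpha> * \<beta>\<close>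
  times its star capacity, hence by its capacity. Maximality: an edge lighter than \<mu> has
  positive level. By \<open>edge_level_attained\<close> some endpoint has that same level, and the
  lower half of the invariant holds there, giving exactly the load that maximality demands.\<close>

text \<open>The bridge from the invariants, which concern nodes, to edges; it rests on edges being
  finite and nonempty.\<close>

lemma edge_level_attained:
  assumes "hypergraph V E I" "e \<in> E"
  obtains v where "v \<in> edge_nodes V I e" "l v = edge_level V I l e"
proof -
  have "finite (edge_nodes V I e)" "edge_nodes V I e \<noteq> {}"
    using assms by (auto simp: hypergraph_def edge_nodes_def)
  then have "Max (l ` edge_nodes V I e) \<in> l ` edge_nodes V I e"
    by (intro Max_in) auto
  then show ?thesis
    using that by (auto simp: edge_level_def)
qed

lemma edge_weight_le:
  assumes "\<beta> \<ge> 1" "\<mu> \<ge> 0" "edge_level V I l e \<ge> 0"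
  shows "edge_weight \<beta> \<mu> V I l e \<le> \<mu>"
proof -
  have "\<beta> powi edge_level V I l e \<ge> 1"
    using assms by (simp add: power_int_def)
  then have "\<beta> powi (- edge_level V I l e) \<le> 1"
    by (simp add: power_int_minus inverse_le_1_iff)
  then show ?thesis
    using assms by (simp add: edge_weight_def mult_left_le)
qed

theorem theorem3:
  fixes V :: "'v set" and E :: "'e set" and I :: "'v \<Rightarrow> 'e set"
    and c :: "'v \<Rightarrow> real" and \<mu> \<alpha> \<beta> :: real and m f :: nat and l :: "'v \<Rightarrow> int"
  assumes "hypergraph V E I"
    and "card E \<le> m"
    and "\<forall>v\<in>V. c v > 0"
    and "\<mu> \<ge> 1"
    and "\<forall>e\<in>E. card (edge_nodes V I e) \<le> f"
    and "\<alpha> > 1" and "\<beta> > 1"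
    and "ab_partition \<alpha> \<beta> m \<mu> V c l"
    and "\<forall>v\<in>V. l v > 0 \<longrightarrow>
           star_capacity \<alpha> \<beta> f c v \<le> node_weight \<beta> \<mu> V I l v \<and>
           node_weight \<beta> \<mu> V I l v \<le> real f * \<alpha> * \<beta> * star_capacity \<alpha> \<beta> f c v"
    and "\<forall>v\<in>V. l v = 0 \<longrightarrow>
           node_weight \<beta> \<mu> V I l v \<le> real f * \<alpha> * \<beta> * star_capacity \<alpha> \<beta> f c v"
  shows "lp_maximal (real f * \<alpha> * \<beta>) V E I c \<mu> (edge_weight \<beta> \<mu> V I l)"
proof -
  let ?w = "edge_weight \<beta> \<mu> V I l"
  have level_nonneg: "l v \<ge> 0" if "v \<in> V" for v
    using assms(8) that by (auto simp: ab_partition_def)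
  have "0 \<le> ?w e \<and> ?w e \<le> \<mu>" if e: "e \<in> E" for e
  proof -
    obtain v where "v \<in> edge_nodes V I e" "l v = edge_level V I l e"
      using edge_level_attained[OF assms(1) e] .
    then have "edge_level V I l e \<ge> 0"
      using level_nonneg by (force simp: edge_nodes_def)
    then show ?thesis
      \<comment> \<open>The final \<open>simp\<close> proves nonnegativity, as both factors of the
        weight are nonnegative.\<close>
      using assms(4,7) by (auto intro!: edge_weight_le) (simp add: edge_weight_def)
  qed
  moreover have "(\<Sum>e\<in>I v. ?w e) \<le> c v" if v: "v \<in> V" for v
  proof -
    have "node_weight \<beta> \<mu> V I l v \<le> real f * \<alpha> * \<beta> * star_capacity \<alpha> \<beta> f c v"
      \<comment> \<open>Both cases of the invariant share this upper bound, and nonnegative levels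
        leave no third case.\<close>
      using assms(9,10) level_nonneg[OF v] v by (cases "l v = 0") auto
    \<comment> \<open>Only an inequality: for \<open>f = 0\<close> division by zero makes the left-hand side \<open>0\<close>.\<close>
    also have "\<dots> \<le> c v"
      using assms(3,6,7) v by (auto simp: star_capacity_def less_imp_le)
    finally show ?thesis
      by (simp add: node_weight_def)
  qed
  moreover have "\<exists>v\<in>edge_nodes V I e. (\<Sum>e'\<in>I v. ?w e') \<ge> c v / (real f * \<alpha> * \<beta>)"
    if e: "e \<in> E" and less: "?w e < \<mu>" for e
  proof -
    \<comment> \<open>The witness is an endpoint of highest level.\<close>
    obtain v where v: "v \<in> edge_nodes V I e" "l v = edge_level V I l e"
      using edge_level_attained[OF assms(1) e] .
    then have "v \<in> V"
      by (simp add: edge_nodes_def)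
    \<comment> \<open>At level 0 the weight would be \<open>\<mu> * \<beta> powi 0\<close>, which is
      \<mu>, against \<open>less\<close>.\<close>
    moreover have "l v \<noteq> 0"
      using less v(2) by (auto simp: edge_weight_def)
    ultimately have "star_capacity \<alpha> \<beta> f c v \<le> node_weight \<beta> \<mu> V I l v"
      using assms(9) level_nonneg[of v] by auto
    then show ?thesis
      using v(1) by (auto simp: star_capacity_def node_weight_def)
  qed
  ultimately show ?thesis
    by (simp add: lp_maximal_def lp_feasible_def)
qed

end
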